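(* Let $\mu\preceq_{\mathrm{st}}\nu$ be atomless Borel probability measures on $\mathbb{R}$. Let $F=F_\mu-F_\nu$, $H=\{(x,z)\in\mathbb{R}^2: z\le F(x)\}$ and $T(x)=\inf\{y\ge x:(y,F(x))\notin H\}$ for $x\in\mathbb{R}$ (with $\inf\emptyset=\infty$). Then $$P_*(\mu,\nu)=(\mu\wedge\nu)\otimes_x\delta_x+\mu'\otimes_x\delta_{T(x)},$$ where $\mu'=\mu-\mu\wedge\nu$. In particular, $P_*(\mu,\nu)$ is of Monge-type if and only if $\mu'$ and $\mu\wedge\nu$ are mutually singular.
   Context: For finite Borel measures $\theta_1,\theta_2$ on $\mathbb{R}$ with cdf's $F_{\theta_i}(t)=\theta_i((-\infty,t])$, $\theta_1\preceq_{\mathrm{st}}\theta_2$ means $\theta_1(\mathbb{R})=\theta_2(\mathbb{R})$ and $F_{\theta_1}\ge F_{\theta_2}$; $\theta_1\le\theta_2$ means $\theta_1(A)\le\theta_2(A)$ for all Borel $A$. $\mu\wedge\nu$ is the maximal measure $\theta$ with $\theta\le\mu$ and $\theta\le\nu$. A directional coupling of $\mu,\nu$ is a probability measure on $\mathbb{R}^2$ with first marginal $\mu$ and second marginal $\nu$ concentrated on $\mathbb{H}=\{(x,y):y\ge x\}$. $P_*(\mu,\nu)$ denotes the optimal directional coupling: the unique directional coupling $P$ of $\mu,\nu$ such that $P((x,\infty)\times\cdot)=\nu_x$ for all $x\in\mathbb{R}$, where $\nu_x$ is the unique minimal element for $\preceq_{\mathrm{st}}$ of $\{\theta:\mu|_{(x,\infty)}\preceq_{\mathrm{st}}\theta\le\nu\}$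 (equivalently, $F_{\nu_x}$ is the supremum of $F_\theta$ over this set). Existence and uniqueness hold whenever $\mu\preceq_{\mathrm{st}}\nu$. For a finite measure $\alpha$ on $\mathbb{R}$ and a map $S$ that is finite $\alpha$-a.e., $\alpha\otimes_x\delta_{S(x)}$ is the pushforward of $\alpha$ under $x\mapsto(x,S(x))$. A coupling $P$ of $\mu,\nu$ is of Monge-type if $P=\mu\otimes_x\delta_{S(x)}$ for some measurable map $S$. *)

theory Defs
  imports "HOL-Probability.Probability"
begin

text \<open>
  Finite Borel measures on the line are modelled by the locale predicate
  \<^const>\<open>finite_borel_measure\<close>, Borel probability measures by \<^const>\<open>real_distribution\<close>,
  and distribution functions by \<^const>\<open>cdf\<close>. On measures with a common \<open>\<sigma>\<close>-algebra the
  library order \<open>\<le>\<close> is the setwise order (fact \<open>le_measure\<close>), and \<open>inf \<mu> \<nu>\<close> in the library's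
  complete lattice of measures is the maximal measure below \<open>\<mu>\<close> and \<open>\<nu>\<close>; as that lattice contains
  measures on all \<open>\<sigma>\<close>-algebras, \<open>sets_inf_measure\<close> below records that no \<open>\<sigma>\<close>-algebra is lost.
\<close>

lemma sets_inf_measure:
  fixes \<mu> \<nu> :: "'a measure"
  assumes "sets \<mu> = sets \<nu>"
  shows "sets (inf \<mu> \<nu>) = sets \<mu>"
proof -
  have sp: "space \<mu> = space \<nu>"
    using assms by (rule sets_eq_imp_space_eq)
  have "null_measure \<mu> \<le> inf \<mu> \<nu>"
    using assms by (intro inf_greatest) (simp_all add: le_measure)
  moreover have "inf \<mu> \<nu> \<le> \<mu>"
    by (rule inf_le1)
  ultimately show ?thesis
    using sp by (auto simp: le_measure_iff split: if_split_asm)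
qed

definition atomless :: "real measure \<Rightarrow> bool" where
  "atomless \<mu> \<longleftrightarrow> (\<forall>x. emeasure \<mu> {x} = 0)"

definition mutually_singular :: "'a measure \<Rightarrow> 'a measure \<Rightarrow> bool" where
  "mutually_singular \<alpha> \<beta> \<longleftrightarrow>
     (\<exists>A \<in> sets \<alpha> \<inter> sets \<beta>. emeasure \<alpha> A = 0 \<and> emeasure \<beta> (space \<beta> - A) = 0)"

definition add_measure :: "'a measure \<Rightarrow> 'a measure \<Rightarrow> 'a measure" where
  "add_measure \<alpha> \<beta> = measure_of (space \<alpha>) (sets \<alpha>) (\<lambda>A. emeasure \<alpha> A + emeasure \<beta> A)"

lemma sets_add_measure [simp]: "sets (add_measure \<alpha> \<beta>) = sets \<alpha>"
  by (simp add: add_measure_def)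

lemma emeasure_add_measure:
  assumes "sets \<alpha> = sets \<beta>" and "A \<in> sets \<alpha>"
  shows "emeasure (add_measure \<alpha> \<beta>) A = emeasure \<alpha> A + emeasure \<beta> A"
  unfolding add_measure_def
proof (rule emeasure_measure_of_sigma)
  show "sigma_algebra (space \<alpha>) (sets \<alpha>)" ..
  show "positive (sets \<alpha>) (\<lambda>A. emeasure \<alpha> A + emeasure \<beta> A)"
    by (simp add: positive_def)
  show "countably_additive (sets \<alpha>) (\<lambda>A. emeasure \<alpha> A + emeasure \<beta> A)"
  proof (rule countably_additiveI)
    fix A :: "nat \<Rightarrow> 'a set"
    assume A: "range A \<subseteq> sets \<alpha>" "disjoint_family A"
    then show "(\<Sum>i. emeasure \<alpha> (A i) + emeasure \<beta> (A i)) =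
        emeasure \<alpha> (\<Union> (range A)) + emeasure \<beta> (\<Union> (range A))"
      using assms(1) by (simp add: suminf_add[symmetric] suminf_emeasure)
  qed
  show "A \<in> sets \<alpha>" by fact
qed

definition st_le :: "real measure \<Rightarrow> real measure \<Rightarrow> bool" where
  "st_le \<theta>\<^sub>1 \<theta>\<^sub>2 \<longleftrightarrow>
     measure \<theta>\<^sub>1 UNIV = measure \<theta>\<^sub>2 UNIV \<and> (\<forall>t. cdf \<theta>\<^sub>1 t \<ge> cdf \<theta>\<^sub>2 t)"

definition directional_coupling ::
    "real measure \<Rightarrow> real measure \<Rightarrow> (real \<times> real) measure \<Rightarrow> bool" where
  "directional_coupling \<mu> \<nu> P \<longleftrightarrow>
     prob_space P \<and> sets P = sets borel \<and>
     distr P borel fst = \<mu> \<and> distr P borel snd = \<nu> \<and>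
     measure P {(x, y). y \<ge> x} = 1"

text \<open>
  The restriction of \<open>\<mu>\<close> to \<open>(x, \<infinity>)\<close> has to remain a measure on the whole line, hence
  \<^const>\<open>density\<close> rather than \<^const>\<open>restrict_space\<close>.
\<close>

definition restrict_above :: "real measure \<Rightarrow> real \<Rightarrow> real measure" where
  "restrict_above \<mu> x = density \<mu> (indicator {x<..})"

definition target_candidates :: "real measure \<Rightarrow> real measure \<Rightarrow> real \<Rightarrow> real measure set" where
  "target_candidates \<mu> \<nu> x =
     {\<theta>. finite_borel_measure \<theta> \<and> st_le (restrict_above \<mu> x) \<theta> \<and> \<theta> \<le> \<nu>}"

definition minimal_target :: "real measure \<Rightarrow> real measure \<Rightarrow> real \<Rightarrow> real measure" where
  "minimal_target \<mu> \<nu> x =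
     (THE \<theta>. \<theta> \<in> target_candidates \<mu> \<nu> x \<and>
        (\<forall>\<theta>' \<in> target_candidates \<mu> \<nu> x. st_le \<theta>' \<theta> \<longrightarrow> \<theta>' = \<theta>))"

definition optimal_coupling :: "real measure \<Rightarrow> real measure \<Rightarrow> (real \<times> real) measure" where
  "optimal_coupling \<mu> \<nu> =
     (THE P. directional_coupling \<mu> \<nu> P \<and>
        (\<forall>x. \<forall>B \<in> sets borel. emeasure P ({x<..} \<times> B) = emeasure (minimal_target \<mu> \<nu> x) B))"

text \<open>
  The measure \<open>\<alpha> \<otimes>\<^sub>x \<delta>\<^bsub>S(x)\<^esub>\<close>. It is meaningful only if \<open>S\<close> is measurable and finite
  \<open>\<alpha>\<close>-almost everywhere, since \<^const>\<open>real_of_ereal\<close> sends infinite values to \<open>0\<close>.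
\<close>

definition graph_measure :: "real measure \<Rightarrow> (real \<Rightarrow> ereal) \<Rightarrow> (real \<times> real) measure" where
  "graph_measure \<alpha> S = distr \<alpha> borel (\<lambda>x. (x, real_of_ereal (S x)))"

definition monge_type :: "real measure \<Rightarrow> (real \<times> real) measure \<Rightarrow> bool" where
  "monge_type \<mu> P \<longleftrightarrow>
     (\<exists>S \<in> borel_measurable borel. (AE x in \<mu>. \<bar>S x\<bar> \<noteq> \<infinity>) \<and> P = graph_measure \<mu> S)"

definition cdf_gap :: "real measure \<Rightarrow> real measure \<Rightarrow> real \<Rightarrow> real" where
  "cdf_gap \<mu> \<nu> x = cdf \<mu> x - cdf \<nu> x"

definition hypograph :: "(real \<Rightarrow> real) \<Rightarrow> (real \<times> real) set" where
  "hypograph F = {(x, z). z \<le> F x}"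

definition exit_point :: "(real \<Rightarrow> real) \<Rightarrow> real \<Rightarrow> ereal" where
  "exit_point F x = Inf (ereal ` {y. y \<ge> x \<and> (y, F x) \<notin> hypograph F})"

end

theory Submission
  imports Defs
begin

text \<open>
  Write \<open>F = F\<^sub>\<mu> - F\<^sub>\<nu>\<close>. This function is continuous and nonnegative and vanishes at both ends of the
  line. If \<open>\<theta>\<close> is a candidate target of \<open>\<mu>\<close> restricted to \<open>(x, \<infinity>)\<close> and \<open>x \<le> s \<le> t\<close>, then
  the stochastic order bounds the mass of \<open>\<theta>\<close> up to \<open>s\<close> and \<open>\<theta> \<le> \<nu>\<close> bounds the rest, so that
  \<open>F\<^sub>\<theta>(t) \<le> \<mu>(x, s] + \<nu>(s, t] = F\<^sub>\<nu>(t) - F\<^sub>\<mu>(x) + F(s)\<close>. Taking the best \<open>s\<close> gives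
  \<open>F\<^sub>\<theta>(t) \<le> F\<^sub>\<nu>(t) - F\<^sub>\<mu>(x) + min\<^bsub>[x,t]\<^esub> F\<close>. For a directional coupling the mass of
  \<open>(x, \<infinity>) \<times> (-\<infinity>, t]\<close> is \<open>F\<^sub>\<nu>(t) - F\<^sub>\<mu>(x)\<close> plus the mass that jumps over \<open>[x, t]\<close>. A directional
  coupling in which this jumping mass equals \<open>min\<^bsub>[x,t]\<^esub> F\<close> for all \<open>x \<le> t\<close> therefore has the least
  candidates as its slices, and it is the optimal one (\<open>slice_above_least\<close>, \<open>optimal_coupling_eqI\<close>).

  It remains to compute the jumping mass of the proposed coupling. Only \<open>\<mu>'\<close> contributes, and it
  contributes the points \<open>u \<le> x\<close> with \<open>T u > t\<close>. Up to an arbitrarily small change of \<open>t\<close>, these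
  are the points of \<open>(-\<infinity>, x]\<close> in the closed set \<open>A\<close> of all \<open>u \<le> t\<close> at which \<open>F\<close> takes its minimum
  over \<open>[u, t]\<close>. On each gap of \<open>A\<close> the function \<open>F\<close> makes an excursion and returns to
  its initial value, so \<open>\<mu>\<close> and \<open>\<nu>\<close> charge the gap equally. Hence the growth of \<open>F\<close> takes place
  on \<open>A\<close> alone, which gives
  \<open>(\<mu> - \<nu>)(A \<inter> (-\<infinity>, x]) = min\<^bsub>[x,t]\<^esub> F\<close> (\<open>measure_diff_future_minima\<close>). The right-hand side is
  increasing in \<open>x\<close>, so \<open>\<nu> \<le> \<mu>\<close> on \<open>A\<close>; there \<open>\<mu> \<and> \<nu>\<close> is \<open>\<nu>\<close> and \<open>\<mu>'\<close> is \<open>\<mu> - \<nu>\<close>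
  (\<open>excess_crossing\<close>). The case \<open>x = t\<close> also shows that the second marginal is \<open>\<nu>\<close>.

  For the Monge property, the part of a coupling on the diagonal lies below both marginals, hence
  below \<open>\<mu> \<and> \<nu>\<close>. The summand \<open>(\<mu> \<and> \<nu>) \<otimes>\<^sub>x \<delta>\<^sub>x\<close> uses up this bound, so \<open>T x \<noteq> x\<close> for
  \<open>\<mu>'\<close>-almost every \<open>x\<close> (\<open>excess_fixed_null\<close>). If the coupling is carried by one graph, the fixed
  points of the graph map thus separate \<open>\<mu> \<and> \<nu>\<close> from \<open>\<mu>'\<close>.
\<close>

section \<open>Comparing measures on the line\<close>

text \<open>An open set is the disjoint union of its countably many components.\<close>

lemma measure_eq_if_eq_on_components:
  fixes U :: "'a::{euclidean_space} set"
  assumes "open U" and sets: "sets \<alpha> = sets borel" "sets \<beta> = sets borel"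
    and eq: "\<And>C. C \<in> components U \<Longrightarrow> emeasure \<alpha> C = emeasure \<beta> C"
  shows "emeasure \<alpha> U = emeasure \<beta> U"
proof -
  have op: "open C" if "C \<in> components U" for C
    using that \<open>open U\<close> by (rule open_components[rotated])
  have disj: "disjoint (components U)"
    using pairwise_disjoint_components[of U] by (simp add: pairwise_def disjnt_def)
  have cnt: "countable (components U)"
    using op disj by (rule countable_disjoint_open_subsets)
  have U: "U = (\<Union>C\<in>components U. C)"
    using Union_components[of U] by simp
  have fam: "disjoint_family_on (\<lambda>C. C) (components U)"
    using disj by (auto simp: disjoint_family_on_def pairwise_def disjnt_def)
  have "emeasure \<alpha> U = (\<integral>\<^sup>+C. emeasure \<alpha> C \<partial>count_space (components U))"
    by (subst U, rule emeasure_UN_countable) (use cnt fam op sets in auto)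
  also have "\<dots> = (\<integral>\<^sup>+C. emeasure \<beta> C \<partial>count_space (components U))"
    by (rule nn_integral_cong) (simp add: eq)
  also have "\<dots> = emeasure \<beta> U"
    by (subst (2) U, rule emeasure_UN_countable[symmetric]) (use cnt fam op sets in auto)
  finally show ?thesis .
qed

text \<open>
  The gaps of a closed set have their endpoints in the set. Truncating at a point \<open>b\<close> of the set
  itself keeps this true for the last gap.
\<close>
lemma component_below_cases:
  fixes A :: "real set"
  assumes A: "closed A" "b \<in> A" and C: "C \<in> components ({..<b} - A)"
  obtains d where "d \<in> A" "C = {..<d}"
    | c d where "c \<in> A" "d \<in> A" "c < d" "C = {c<..<d}"
proof -
  let ?U = "{..<b} - A"
  from C obtain u where u: "u \<in> ?U" "C = connected_component_set ?U u"
    by (auto simp: components_iff)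
  have conn: "connected C" and "u \<in> C" "C \<subseteq> ?U"
    using u in_components_connected[OF C] in_components_subset[OF C] by (auto simp: connected_component_refl_eq)
  have seg: "z \<in> C" if "w \<in> C" "min u w \<le> z" "z \<le> max u w" for w z
    using connectedD_interval[OF conn, of "min u w" "max u w" z] that \<open>u \<in> C\<close>
    by (auto simp: min_def max_def split: if_splits)
  have max: "J \<subseteq> C" if "connected J" "u \<in> J" "J \<subseteq> ?U" for J
    unfolding u(2) using that by (intro connected_component_maximal)
  define d where "d = Inf (A \<inter> {u..})"
  have ne: "A \<inter> {u..} \<noteq> {}" using \<open>b \<in> A\<close> u by (auto intro: exI[of _ b])
  have bd: "bdd_below (A \<inter> {u..})" by (auto intro: bdd_belowI[of _ u])
  have d: "d \<in> A" "u \<le> d"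
    using closed_contains_Inf[OF ne bd] A(1) unfolding d_def by auto
  have dle: "d \<le> z" if "z \<in> A" "u \<le> z" for z
    unfolding d_def using bd that by (intro cInf_lower) auto
  have ud: "u < d" using d u by (cases "u = d") auto
  have db: "d \<le> b" using dle[OF \<open>b \<in> A\<close>] u by auto
  have Cd: "w < d" if "w \<in> C" for w
  proof (rule ccontr)
    assume "\<not> w < d"
    then have "d \<in> C" using seg[OF that, of d] ud by auto
    with d \<open>C \<subseteq> ?U\<close> show False by auto
  qed
  show thesis
  proof (cases "A \<inter> {..u} = {}")
    case True
    have "{..<d} \<subseteq> C"
      by (rule max) (use ud db dle True in \<open>auto, force\<close>)
    with Cd have "C = {..<d}" by auto
    with d show thesis using that(1) by blast
  next
    case False
    define c where "c = Sup (A \<inter> {..u})"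
    have bda: "bdd_above (A \<inter> {..u})" by (auto intro: bdd_aboveI[of _ u])
    have c: "c \<in> A" "c \<le> u"
      using closed_contains_Sup[OF False bda] A(1) unfolding c_def by auto
    have cle: "z \<le> c" if "z \<in> A" "z \<le> u" for z
      unfolding c_def using bda that by (intro cSup_upper) auto
    have cu: "c < u" using c u by (cases "u = c") auto
    have Cc: "c < w" if "w \<in> C" for w
    proof (rule ccontr)
      assume "\<not> c < w"
      then have "c \<in> C" using seg[OF that, of c] cu by auto
      with c \<open>C \<subseteq> ?U\<close> show False by auto
    qed
    have "{c<..<d} \<subseteq> C"
    proof (rule max)
      show "{c<..<d} \<subseteq> ?U"
      proof
        fix z assume "z \<in> {c<..<d}"
        with cle[of z] dle[of z] db show "z \<in> ?U" by (cases "z \<le> u") auto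
      qed
    qed (use cu ud in auto)
    with Cd Cc have "C = {c<..<d}" by auto
    with c d cu ud show thesis using that(2)[of c d] by auto
  qed
qed

lemma finite_borel_measureI:
  assumes "sets M = sets borel" and "emeasure M (space M) \<noteq> \<infinity>"
  shows "finite_borel_measure M"
  using assms
  by (intro finite_borel_measure.intro finite_measureI) (simp_all add: finite_borel_measure_axioms_def)

text \<open>
  The difference of the distribution functions is itself the distribution function of a measure
  \<open>\<gamma>\<close>, and uniqueness gives \<open>\<alpha> = \<beta> + \<gamma>\<close>.
\<close>
lemma measure_le_if_cdf_diff_mono:
  assumes "finite_borel_measure \<alpha>" "finite_borel_measure \<beta>"
    and mono: "mono (\<lambda>x. cdf \<alpha> x - cdf \<beta> x)"
  shows "\<beta> \<le> \<alpha>"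
proof -
  interpret a: finite_borel_measure \<alpha> by fact
  interpret b: finite_borel_measure \<beta> by fact
  define G where "G = (\<lambda>x. cdf \<alpha> x - cdf \<beta> x)"
  define m where "m = measure \<alpha> (space \<alpha>) - measure \<beta> (space \<beta>)"
  have G_mono: "G x \<le> G y" if "x \<le> y" for x y
    using monoD[OF mono that] by (simp add: G_def)
  have G_bot: "(G \<longlongrightarrow> 0) at_bot"
    unfolding G_def using tendsto_diff[OF a.cdf_lim_at_bot b.cdf_lim_at_bot] by simp
  have G_top: "(G \<longlongrightarrow> m) at_top"
    unfolding G_def m_def by (intro tendsto_diff a.cdf_lim_at_top b.cdf_lim_at_top)
  have G_right: "continuous (at_right x) G" for x
    unfolding G_def by (intro continuous_intros a.cdf_is_right_cont b.cdf_is_right_cont)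
  have G_nonneg: "0 \<le> G x" for x
  proof (rule tendsto_upperbound[OF G_bot])
    show "\<forall>\<^sub>F y in at_bot. G y \<le> G x"
      using eventually_le_at_bot[of x] by eventually_elim (rule G_mono)
  qed simp
  have "0 \<le> m"
    by (rule tendsto_lowerbound[OF G_top]) (simp_all add: G_nonneg)
  define \<gamma> where "\<gamma> = interval_measure G"
  have "finite_borel_measure \<gamma>"
    unfolding \<gamma>_def
    by (rule finite_borel_measure_interval_measure[OF G_mono G_right G_bot G_top \<open>0 \<le> m\<close>])
  then interpret g: finite_borel_measure \<gamma> .
  have sets_eq: "sets \<beta> = sets \<gamma>" using b.M_is_borel g.M_is_borel by simp
  define \<delta> where "\<delta> = add_measure \<beta> \<gamma>"
  have sets_\<delta>: "sets \<delta> = sets borel" by (simp add: \<delta>_def b.M_is_borel)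
  have em: "emeasure \<delta> B = emeasure \<beta> B + emeasure \<gamma> B" if "B \<in> sets borel" for B
    unfolding \<delta>_def using that b.M_is_borel by (intro emeasure_add_measure sets_eq) simp
  have "space \<delta> = UNIV" using sets_eq_imp_space_eq[OF sets_\<delta>] by simp
  then have "finite_borel_measure \<delta>"
    by (intro finite_borel_measureI sets_\<delta>)
       (simp add: em b.emeasure_eq_measure g.emeasure_eq_measure)
  then interpret d: finite_borel_measure \<delta> .
  have me: "measure \<delta> B = measure \<beta> B + measure \<gamma> B" if "B \<in> sets borel" for B
    using em[OF that] by (simp add: b.emeasure_eq_measure g.emeasure_eq_measure d.emeasure_eq_measure ennreal_plus[symmetric] del: ennreal_plus)
  have cdf_\<gamma>: "cdf \<gamma> = G"
  proof
    fix x
    have "measure \<gamma> {y<..x} = G x - G y" if "y \<le> x" for y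
      unfolding \<gamma>_def measure_def using that
      by (subst emeasure_interval_measure_Ioc) (auto simp: G_mono G_right)
    then have *: "cdf \<gamma> x - cdf \<gamma> y = G x - G y" if "y < x" for y
      using that g.cdf_diff_eq[OF that] by simp
    have "((\<lambda>y. cdf \<gamma> x - cdf \<gamma> y) \<longlongrightarrow> cdf \<gamma> x - 0) at_bot"
      by (intro tendsto_intros g.cdf_lim_at_bot)
    moreover have "((\<lambda>y. cdf \<gamma> x - cdf \<gamma> y) \<longlongrightarrow> G x - 0) at_bot"
    proof (rule Lim_transform_eventually)
      show "((\<lambda>y. G x - G y) \<longlongrightarrow> G x - 0) at_bot" by (intro tendsto_intros G_bot)
      show "\<forall>\<^sub>F y in at_bot. G x - G y = cdf \<gamma> x - cdf \<gamma> y"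
        using eventually_gt_at_bot[of x] by eventually_elim (simp add: *)
    qed
    ultimately have "cdf \<gamma> x - 0 = G x - 0"
      by (rule tendsto_unique[rotated]) simp
    then show "cdf \<gamma> x = G x" by simp
  qed
  have "cdf \<delta> = cdf \<alpha>"
    using cdf_\<gamma> by (auto simp: cdf_def me G_def fun_eq_iff)
  then have "\<delta> = \<alpha>"
    by (intro cdf_unique' \<open>finite_borel_measure \<delta>\<close> assms)
  then show ?thesis
    using em b.M_is_borel a.M_is_borel by (auto simp: le_measure)
qed

section \<open>Future minima and the exit point\<close>

definition future_minima :: "(real \<Rightarrow> real) \<Rightarrow> real \<Rightarrow> real set" where
  "future_minima F t = {u. u \<le> t \<and> (\<forall>y\<in>{u..t}. F u \<le> F y)}"

text \<open>
  Comparing \<open>F u\<close> with \<open>F (max u y)\<close> for every \<open>y \<le> t\<close> removes the dependence of the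
  range of \<open>y\<close> on \<open>u\<close> and exhibits the set as an intersection of closed sets.
\<close>
lemma closed_future_minima:
  assumes "continuous_on UNIV F"
  shows "closed (future_minima F t)"
proof -
  have "future_minima F t = {..t} \<inter> (\<Inter>y\<in>{..t}. {u. F u \<le> F (max u y)})"
    by (auto simp: future_minima_def max_def)
  moreover have "closed {u. F u \<le> F (max u y)}" for y
    by (intro closed_Collect_le continuous_intros continuous_on_compose2[OF assms] assms) auto
  ultimately show ?thesis
    by (simp only:) (intro closed_Int closed_INT closed_atMost ballI)
qed

lemma minimizer_on_interval:
  fixes F :: "real \<Rightarrow> real"
  assumes "continuous_on UNIV F" "x \<le> t"
  obtains y where "y \<in> {x..t}" "\<forall>z\<in>{x..t}. F y \<le> F z"
proof -
  have "continuous_on {x..t} F" using assms(1) by (rule continuous_on_subset) simp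
  then have "\<exists>y\<in>{x..t}. \<forall>z\<in>{x..t}. F y \<le> F z"
    using assms(2) by (intro continuous_attains_inf) auto
  with that show thesis by blast
qed

text \<open>
  A minimizer of \<open>F\<close> over \<open>[w, t]\<close> is a future minimum, so lower bounds need to be checked only at
  future minima. This is how the values of \<open>F\<close> inside a gap are controlled.
\<close>
lemma le_if_le_on_future_minima:
  assumes "continuous_on UNIV F" "w \<le> t"
    and "\<And>z. z \<in> future_minima F t \<Longrightarrow> w \<le> z \<Longrightarrow> k \<le> F z"
  shows "k \<le> F w"
proof -
  obtain z where z: "z \<in> {w..t}" "\<forall>v\<in>{w..t}. F z \<le> F v"
    using minimizer_on_interval assms(1,2) by blast
  then have "z \<in> future_minima F t" by (auto simp: future_minima_def)
  with assms(3) z have "k \<le> F z" by auto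
  also have "F z \<le> F w" using z assms(2) by auto
  finally show ?thesis .
qed

lemma exit_point_eq_Inf: "exit_point F u = Inf (ereal ` {y. u \<le> y \<and> F y < F u})"
  by (simp add: exit_point_def hypograph_def not_le)

lemma le_exit_point: "ereal u \<le> exit_point F u"
  unfolding exit_point_eq_Inf by (rule Inf_greatest) auto

text \<open>
  The next two lemmas sandwich \<open>{u. t < exit_point F u}\<close>, for arguments \<open>u \<le> t\<close>, between the
  future minima for any \<open>s > t\<close> and those for \<open>t\<close>. Equality may fail: \<open>exit_point F u = t\<close> is
  possible at a future minimum \<open>u\<close> for \<open>t\<close>.
\<close>
lemma future_minima_if_less_exit_point:
  assumes "u \<le> t" "ereal t < exit_point F u"
  shows "u \<in> future_minima F t"
proof -
  have "F u \<le> F y" if "u \<le> y" "y \<le> t" for y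
  proof (rule ccontr)
    assume "\<not> F u \<le> F y"
    with that have "exit_point F u \<le> ereal y"
      unfolding exit_point_eq_Inf by (intro Inf_lower) auto
    with assms that show False by (metis ereal_less_eq(3) leD order_trans)
  qed
  with assms show ?thesis by (auto simp: future_minima_def)
qed

lemma le_exit_point_if_future_minima:
  assumes "u \<in> future_minima F t"
  shows "ereal t \<le> exit_point F u"
  unfolding exit_point_eq_Inf
  using assms by (intro Inf_greatest) (force simp: future_minima_def not_less)

lemma borel_measurable_exit_point:
  assumes "continuous_on UNIV F"
  shows "exit_point F \<in> borel_measurable borel"
proof (rule borel_measurableI_greater)
  fix y :: ereal
  show "{u \<in> space borel. y < exit_point F u} \<in> sets borel"
  proof (cases y)
    case (real t)
    have "{u. ereal t < exit_point F u} = {t<..} \<union> (\<Union>n. future_minima F (t + 1 / real (Suc n)) \<inter> {..t})"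
      (is "?L = ?R")
    proof (intro set_eqI iffI)
      fix u assume u: "u \<in> ?L"
      then obtain s where s: "t < s" "ereal s < exit_point F u"
        using ereal_dense3[of "ereal t" "exit_point F u"] by (auto)
      then obtain n where n: "1 / real (Suc n) < s - t"
        using nat_approx_posE[of "s - t"] by (metis diff_gt_0_iff_gt)
      have "u \<in> future_minima F (t + 1 / real (Suc n))" if "u \<le> t"
      proof (rule future_minima_if_less_exit_point)
        show "u \<le> t + 1 / real (Suc n)" using that by (simp add: add_increasing2)
        have "ereal (t + 1 / real (Suc n)) < ereal s" using n by simp
        then show "ereal (t + 1 / real (Suc n)) < exit_point F u" using s(2) by (rule less_trans)
      qed
      then show "u \<in> ?R" by (cases "u \<le> t") auto
    next
      fix u assume "u \<in> ?R"
      then consider "t < u" | n where "u \<in> future_minima F (t + 1 / real (Suc n))" by auto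
      then show "u \<in> ?L"
      proof cases
        case 1
        then have "ereal t < ereal u" by simp
        then have "ereal t < exit_point F u" using le_exit_point by (rule less_le_trans)
        then show ?thesis by simp
      next
        case 2
        have "ereal t < ereal (t + 1 / real (Suc n))" by simp
        then have "ereal t < exit_point F u"
          using le_exit_point_if_future_minima[OF 2] by (rule less_le_trans)
        then show ?thesis by simp
      qed
    qed
    then show ?thesis
      using real closed_future_minima[OF assms] by (auto simp del: of_nat_Suc)
  next
    case MInf
    have "-\<infinity> < exit_point F u" for u
      by (rule less_le_trans[OF _ le_exit_point]) simp
    then show ?thesis using MInf by simp
  qed simp
qed

section \<open>The mass of the future minima\<close>

locale ordered_atomless_pair =
  fixes \<mu> \<nu> :: "real measure"
  assumes distr_\<mu>: "real_distribution \<mu>" and distr_\<nu>: "real_distribution \<nu>"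
    and atomless_\<mu>: "atomless \<mu>" and atomless_\<nu>: "atomless \<nu>"
    and ordered: "st_le \<mu> \<nu>"
begin

sublocale M: real_distribution \<mu> by (rule distr_\<mu>)
sublocale N: real_distribution \<nu> by (rule distr_\<nu>)

abbreviation F :: "real \<Rightarrow> real" where "F \<equiv> cdf_gap \<mu> \<nu>"

lemma gap_nonneg: "0 \<le> F x"
  using ordered by (simp add: st_le_def cdf_gap_def)

lemma continuous_gap: "continuous_on S F"
proof -
  have "isCont (cdf \<mu>) x" "isCont (cdf \<nu>) x" for x
    using atomless_\<mu> atomless_\<nu> by (simp_all add: M.isCont_cdf N.isCont_cdf atomless_def measure_def)
  then have "isCont F x" for x
    unfolding cdf_gap_def by (intro continuous_intros)
  then show ?thesis by (intro continuous_at_imp_continuous_on) auto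
qed

lemma gap_at_bot: "(F \<longlongrightarrow> 0) at_bot"
  unfolding cdf_gap_def using tendsto_diff[OF M.cdf_lim_at_bot N.cdf_lim_at_bot] by simp

lemma gap_at_top: "(F \<longlongrightarrow> 0) at_top"
  unfolding cdf_gap_def using tendsto_diff[OF M.cdf_lim_at_top_prob N.cdf_lim_at_top_prob] by simp

lemma le_gap_right:
  assumes "c < d" "\<And>w. w \<in> {c<..<d} \<Longrightarrow> k \<le> F w"
  shows "k \<le> F c"
proof (rule tendsto_lowerbound)
  have "isCont F c" using continuous_gap[of UNIV] by (simp add: continuous_on_eq_continuous_at)
  then show "(F \<longlongrightarrow> F c) (at_right c)"
    unfolding isCont_def by (rule tendsto_within_subset) simp
  show "\<forall>\<^sub>F w in at_right c. k \<le> F w"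
    using assms by (auto simp: eventually_at_right)
qed simp

lemma measure_lessThan_eq_cdf: "measure \<mu> {..<x} = cdf \<mu> x" "measure \<nu> {..<x} = cdf \<nu> x"
proof -
  have *: "{..x} = {..<x} \<union> {x}" by auto
  have "measure \<mu> {..x} = measure \<mu> {..<x} + measure \<mu> {x}"
    unfolding * by (rule M.finite_measure_Union) auto
  moreover have "measure \<nu> {..x} = measure \<nu> {..<x} + measure \<nu> {x}"
    unfolding * by (rule N.finite_measure_Union) auto
  ultimately show "measure \<mu> {..<x} = cdf \<mu> x" "measure \<nu> {..<x} = cdf \<nu> x"
    using atomless_\<mu> atomless_\<nu> by (simp_all add: atomless_def measure_def cdf_def)
qed

lemma measure_Ioo_eq_cdf:
  assumes "c < d"
  shows "measure \<mu> {c<..<d} = cdf \<mu> d - cdf \<mu> c" "measure \<nu> {c<..<d} = cdf \<nu> d - cdf \<nu> c"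
proof -
  have *: "{..<d} = {..c} \<union> {c<..<d}" using assms by auto
  have "measure \<mu> {..<d} = measure \<mu> {..c} + measure \<mu> {c<..<d}"
    unfolding * by (rule M.finite_measure_Union) auto
  moreover have "measure \<nu> {..<d} = measure \<nu> {..c} + measure \<nu> {c<..<d}"
    unfolding * by (rule N.finite_measure_Union) auto
  ultimately show "measure \<mu> {c<..<d} = cdf \<mu> d - cdf \<mu> c" "measure \<nu> {c<..<d} = cdf \<nu> d - cdf \<nu> c"
    by (simp_all add: measure_lessThan_eq_cdf) (simp_all add: cdf_def)
qed

text \<open>
  Both measures charge each gap of the future minima equally. The right endpoint \<open>d\<close> of a
  gap is a future minimum, so \<open>F \<ge> F d\<close> in the gap; at the left endpoint \<open>c\<close> this and
  minimality of \<open>c\<close> give \<open>F c = F d\<close>. If the gap extends to \<open>-\<infinity>\<close>, then \<open>F d = 0\<close>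
  because \<open>F\<close> vanishes there.
\<close>
lemma measure_below_future_minimum:
  assumes b: "b \<in> future_minima F t"
  shows "measure \<mu> ({..<b} - future_minima F t) = measure \<nu> ({..<b} - future_minima F t)"
proof -
  let ?A = "future_minima F t"
  have A: "closed ?A" by (intro closed_future_minima continuous_gap)
  have gap_le: "F d \<le> F w" if "d \<in> ?A" "w < d" "{w..<d} \<inter> ?A = {}" for w d
  proof (rule le_if_le_on_future_minima[OF continuous_gap])
    show "w \<le> t" using that by (auto simp: future_minima_def)
    fix z assume z: "z \<in> ?A" "w \<le> z"
    with that(3) have "d \<le> z" by force
    with that(1) z show "F d \<le> F z" by (auto simp: future_minima_def)
  qed
  have "emeasure \<mu> ({..<b} - ?A) = emeasure \<nu> ({..<b} - ?A)"
  proof (rule measure_eq_if_eq_on_components)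
    show "open ({..<b} - ?A)" using A by (intro open_Diff) auto
    fix C assume C: "C \<in> components ({..<b} - ?A)"
    then have CA: "C \<inter> ?A = {}" using in_components_subset by blast
    from A b C show "emeasure \<mu> C = emeasure \<nu> C"
    proof (cases rule: component_below_cases)
      case (1 d)
      have "F d \<le> 0"
      proof (rule tendsto_lowerbound[OF gap_at_bot])
        show "\<forall>\<^sub>F w in at_bot. F d \<le> F w"
          using eventually_gt_at_bot[of d]
          by eventually_elim (rule gap_le, use 1 CA in auto)
      qed simp
      with gap_nonneg[of d] have "F d = 0" by simp
      then show ?thesis
        by (simp add: 1 M.emeasure_eq_measure N.emeasure_eq_measure measure_lessThan_eq_cdf cdf_gap_def)
    next
      case (2 c d)
      have "F d \<le> F c"
        by (rule le_gap_right[OF \<open>c < d\<close>], rule gap_le) (use 2 CA in auto)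
      moreover have "F c \<le> F d" using 2 by (auto simp: future_minima_def)
      ultimately have "measure \<mu> C = measure \<nu> C"
        unfolding 2 measure_Ioo_eq_cdf[OF \<open>c < d\<close>] by (simp add: cdf_gap_def)
      then show ?thesis by (simp add: M.emeasure_eq_measure N.emeasure_eq_measure)
    qed
  qed auto
  then show ?thesis by (simp add: measure_def)
qed

text \<open>
  By the previous lemma the increase of \<open>F\<close> up to the last future minimum \<open>b \<le> x\<close> comes from the
  future minima alone, and \<open>F b\<close> is the minimum over \<open>[x, t]\<close> because \<open>F\<close> stays above that minimum
  between \<open>b\<close> and \<open>x\<close>. The minimum is given by a point \<open>y\<close> where it is attained.
\<close>
lemma measure_diff_future_minima:
  assumes y: "y \<in> {x..t}" "\<forall>z\<in>{x..t}. F y \<le> F z"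
  shows "measure \<mu> (future_minima F t \<inter> {..x}) - measure \<nu> (future_minima F t \<inter> {..x}) = F y"
proof -
  let ?A = "future_minima F t"
  have A: "closed ?A" by (intro closed_future_minima continuous_gap)
  have gap_le: "F y \<le> F w" if "w \<le> x" "{w..x} \<inter> ?A = {}" for w
  proof (rule le_if_le_on_future_minima[OF continuous_gap])
    show "w \<le> t" using that y by auto
    fix z assume z: "z \<in> ?A" "w \<le> z"
    with that(2) have "x \<le> z" by force
    with y z show "F y \<le> F z" by (auto simp: future_minima_def)
  qed
  show ?thesis
  proof (cases "?A \<inter> {..x} = {}")
    case True
    have "F y \<le> 0"
    proof (rule tendsto_lowerbound[OF gap_at_bot])
      show "\<forall>\<^sub>F w in at_bot. F y \<le> F w"
        using eventually_le_at_bot[of x]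
        by eventually_elim (rule gap_le, use True in auto)
    qed simp
    with gap_nonneg[of y] True show ?thesis by simp
  next
    case False
    define b where "b = Sup (?A \<inter> {..x})"
    have bdd: "bdd_above (?A \<inter> {..x})" by (auto intro: bdd_aboveI[of _ x])
    have b: "b \<in> ?A" "b \<le> x"
      using closed_contains_Sup[OF False bdd] A unfolding b_def by auto
    have le_b: "z \<le> b" if "z \<in> ?A" "z \<le> x" for z
      unfolding b_def using bdd that by (intro cSup_upper) auto
    have Ab: "?A \<inter> {..x} = ?A \<inter> {..b}" using b le_b by auto
    have "F y \<le> F b"
    proof (cases "b = x")
      case False
      with b have "b < x" by simp
      show ?thesis
        by (rule le_gap_right[OF \<open>b < x\<close>], rule gap_le) (use le_b in force)+
    qed (use y in auto)
    moreover have "F b \<le> F y" using b y by (auto simp: future_minima_def)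
    ultimately have Fb: "F b = F y" by simp
    have split: "{..b} = (?A \<inter> {..b}) \<union> ({..<b} - ?A)" using b(1) by (auto simp: less_le)
    have meas: "?A \<inter> {..b} \<in> sets borel" "{..<b} - ?A \<in> sets borel" using A by auto
    have "cdf \<mu> b = measure \<mu> (?A \<inter> {..b}) + measure \<mu> ({..<b} - ?A)"
      unfolding cdf_def by (subst split, rule M.finite_measure_Union) (use meas in auto)
    moreover have "cdf \<nu> b = measure \<nu> (?A \<inter> {..b}) + measure \<nu> ({..<b} - ?A)"
      unfolding cdf_def by (subst split, rule N.finite_measure_Union) (use meas in auto)
    ultimately show ?thesis
      using measure_below_future_minimum[OF b(1)] Fb unfolding Ab by (simp add: cdf_gap_def)
  qed
qed

section \<open>The excess measure and its jumps\<close>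

abbreviation common :: "real measure" where "common \<equiv> inf \<mu> \<nu>"
abbreviation excess :: "real measure" where "excess \<equiv> diff_measure \<mu> common"
abbreviation T :: "real \<Rightarrow> ereal" where "T \<equiv> exit_point F"

lemma sets_common [measurable_cong]: "sets common = sets borel"
  by (simp add: sets_inf_measure)

lemma emeasure_common_le: "emeasure common B \<le> emeasure \<mu> B" "emeasure common B \<le> emeasure \<nu> B"
  by (rule le_measureD3[OF inf_le1], simp add: sets_common)
     (rule le_measureD3[OF inf_le2], simp add: sets_common)

sublocale common: finite_borel_measure common
proof (rule finite_borel_measureI[OF sets_common])
  have "emeasure common (space common) \<le> emeasure \<mu> (space common)"
    by (rule emeasure_common_le)
  then show "emeasure common (space common) \<noteq> \<infinity>"
    by (auto simp: M.emeasure_eq_measure top_unique)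
qed

lemma sets_excess [measurable_cong]: "sets excess = sets borel"
  by simp

lemma emeasure_excess:
  assumes "B \<in> sets borel"
  shows "emeasure excess B = emeasure \<mu> B - emeasure common B"
  by (rule emeasure_diff_measure)
     (use assms emeasure_common_le M.finite_measure_axioms common.finite_measure_axioms
       in \<open>auto simp: sets_common\<close>)

sublocale excess: finite_borel_measure excess
proof (rule finite_borel_measureI[OF sets_excess])
  have "space excess = UNIV" using sets_eq_imp_space_eq[OF sets_excess] by simp
  then show "emeasure excess (space excess) \<noteq> \<infinity>"
    by (simp add: emeasure_excess M.emeasure_eq_measure)
qed

lemma emeasure_common_plus_excess:
  assumes "B \<in> sets borel"
  shows "emeasure common B + emeasure excess B = emeasure \<mu> B"
  unfolding emeasure_excess[OF assms]
  by (rule add_diff_inverse_ennreal) (rule emeasure_common_le)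

lemma measure_common_plus_excess:
  assumes "B \<in> sets borel"
  shows "measure common B + measure excess B = measure \<mu> B"
  using emeasure_common_plus_excess[OF assms]
  by (simp add: M.emeasure_eq_measure common.emeasure_eq_measure excess.emeasure_eq_measure
      ennreal_plus[symmetric] del: ennreal_plus)

lemma le_common:
  assumes "sets \<theta> = sets borel" "\<And>B. B \<in> sets borel \<Longrightarrow> emeasure \<theta> B \<le> emeasure \<mu> B"
    "\<And>B. B \<in> sets borel \<Longrightarrow> emeasure \<theta> B \<le> emeasure \<nu> B"
  shows "emeasure \<theta> B \<le> emeasure common B"
proof -
  have "\<theta> \<le> common"
    using assms by (intro inf_greatest) (simp_all add: le_measure)
  then show ?thesis by (rule le_measureD3) (simp add: sets_common assms(1))
qed

text \<open>
  The minimum of \<open>F\<close> over \<open>[x, t]\<close> increases with \<open>x\<close>, so on the future minima \<open>\<mu> - \<nu>\<close> has an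
  increasing distribution function. There \<open>\<nu> \<le> \<mu>\<close>, so \<open>\<nu>\<close> restricted to the future minima is a
  common minorant of \<open>\<mu>\<close> and \<open>\<nu>\<close>.
\<close>
lemma measure_common_future_minima:
  assumes "B \<in> sets borel"
  shows "measure common (future_minima F t \<inter> B) = measure \<nu> (future_minima F t \<inter> B)"
proof -
  let ?A = "future_minima F t"
  have A [measurable]: "?A \<in> sets borel"
    by (intro borel_closed closed_future_minima continuous_gap)
  define \<alpha> where "\<alpha> = density \<mu> (indicator ?A)"
  define \<beta> where "\<beta> = density \<nu> (indicator ?A)"
  have sets_\<alpha>: "sets \<alpha> = sets borel" and sets_\<beta>: "sets \<beta> = sets borel"
    by (simp_all add: \<alpha>_def \<beta>_def)
  have \<alpha>: "emeasure \<alpha> C = emeasure \<mu> (?A \<inter> C)" and \<beta>: "emeasure \<beta> C = emeasure \<nu> (?A \<inter> C)"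
    if "C \<in> sets borel" for C
    using that by (simp_all add: \<alpha>_def \<beta>_def emeasure_restricted)
  have fin: "finite_borel_measure \<alpha>" "finite_borel_measure \<beta>"
    using \<alpha> \<beta> sets_eq_imp_space_eq[OF sets_\<alpha>] sets_eq_imp_space_eq[OF sets_\<beta>]
    by (auto intro!: finite_borel_measureI sets_\<alpha> sets_\<beta> simp: M.emeasure_eq_measure N.emeasure_eq_measure)
  (* The future minima lie in {..t}, so both distribution functions are constant beyond t. *)
  have cdfs: "cdf \<alpha> x - cdf \<beta> x = measure \<mu> (?A \<inter> {..min x t}) - measure \<nu> (?A \<inter> {..min x t})" for x
  proof -
    have "?A \<inter> {..x} = ?A \<inter> {..min x t}" by (auto simp: future_minima_def)
    then show ?thesis by (simp add: cdf_def measure_def \<alpha> \<beta>)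
  qed
  have "mono (\<lambda>x. cdf \<alpha> x - cdf \<beta> x)"
  proof (rule monoI)
    fix x x' :: real assume "x \<le> x'"
    obtain y where y: "y \<in> {min x t..t}" "\<forall>z\<in>{min x t..t}. F y \<le> F z"
      using minimizer_on_interval[OF continuous_gap, of "min x t" t] by auto
    obtain y' where y': "y' \<in> {min x' t..t}" "\<forall>z\<in>{min x' t..t}. F y' \<le> F z"
      using minimizer_on_interval[OF continuous_gap, of "min x' t" t] by auto
    have "F y \<le> F y'" using y y' \<open>x \<le> x'\<close> by auto
    then show "cdf \<alpha> x - cdf \<beta> x \<le> cdf \<alpha> x' - cdf \<beta> x'"
      unfolding cdfs measure_diff_future_minima[OF y] measure_diff_future_minima[OF y'] .
  qed
  with fin have "\<beta> \<le> \<alpha>" by (rule measure_le_if_cdf_diff_mono)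
  then have \<beta>\<alpha>: "emeasure \<beta> C \<le> emeasure \<alpha> C" for C
    by (rule le_measureD3) (simp add: sets_\<alpha> sets_\<beta>)
  have "emeasure \<beta> (?A \<inter> B) \<le> emeasure common (?A \<inter> B)"
  proof (rule le_common[OF sets_\<beta>])
    fix C :: "real set" assume [measurable]: "C \<in> sets borel"
    have "emeasure \<alpha> C \<le> emeasure \<mu> C" by (auto simp: \<alpha> intro!: emeasure_mono)
    with \<beta>\<alpha>[of C] show "emeasure \<beta> C \<le> emeasure \<mu> C" by (rule order_trans)
    show "emeasure \<beta> C \<le> emeasure \<nu> C" by (auto simp: \<beta> intro!: emeasure_mono)
  qed
  then have "emeasure common (?A \<inter> B) = emeasure \<nu> (?A \<inter> B)"
    using emeasure_common_le(2)[of "?A \<inter> B"] assms by (auto simp: \<beta> Int_assoc[symmetric] intro: antisym)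
  then show ?thesis by (simp add: measure_def)
qed

lemma measure_excess_future_minima:
  assumes y: "y \<in> {x..t}" "\<forall>z\<in>{x..t}. F y \<le> F z"
  shows "measure excess (future_minima F t \<inter> {..x}) = F y"
proof -
  have "future_minima F t \<inter> {..x} \<in> sets borel"
    by (intro sets.Int borel_closed closed_future_minima continuous_gap) auto
  from measure_common_plus_excess[OF this] show ?thesis
    using measure_diff_future_minima[OF y] measure_common_future_minima[of "{..x}" t] by simp
qed

lemma measurable_T [measurable]: "T \<in> borel_measurable borel"
  by (intro borel_measurable_exit_point continuous_gap)

text \<open>
  The upper bound uses the future minima for \<open>t\<close>, the lower bound those for some \<open>s > t\<close>. By
  continuity at \<open>t\<close>, the minimum over \<open>[x, s]\<close> is almost that over \<open>[x, t]\<close> when \<open>s\<close> is close to \<open>t\<close>.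
\<close>
lemma excess_crossing:
  assumes y: "y \<in> {x..t}" "\<forall>z\<in>{x..t}. F y \<le> F z"
  shows "measure excess {u. u \<le> x \<and> ereal t < T u} = F y"
proof (rule antisym)
  let ?E = "{u. u \<le> x \<and> ereal t < T u}"
  have [measurable]: "?E \<in> sets borel" by measurable
  have A: "future_minima F s \<in> sets borel" for s
    by (intro borel_closed closed_future_minima continuous_gap)
  have "?E \<subseteq> future_minima F t \<inter> {..x}"
    using y by (auto intro!: future_minima_if_less_exit_point)
  then show "measure excess ?E \<le> F y"
    unfolding measure_excess_future_minima[OF y, symmetric]
    by (rule excess.finite_measure_mono) (use A in auto)
  show "F y \<le> measure excess ?E"
  proof (rule field_le_epsilon)
    fix e :: real assume "0 < e"
    have "isCont F t" using continuous_gap[of UNIV] by (simp add: continuous_on_eq_continuous_at)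
    with \<open>0 < e\<close> obtain d where d: "0 < d" "\<And>z. \<bar>z - t\<bar> < d \<Longrightarrow> \<bar>F z - F t\<bar> < e"
      by (auto simp: continuous_at_eps_delta dist_real_def)
    define s where "s = t + d / 2"
    have "t < s" using d by (simp add: s_def)
    have near: "F t - e < F z" if "z \<in> {t..s}" for z
    proof -
      have "\<bar>z - t\<bar> < d" using that d(1) by (auto simp: s_def)
      from d(2)[OF this] show ?thesis by linarith
    qed
    obtain y' where y': "y' \<in> {x..s}" "\<forall>z\<in>{x..s}. F y' \<le> F z"
      using minimizer_on_interval[OF continuous_gap, of x s] y \<open>t < s\<close> by auto
    have "F y - e \<le> F y'"
    proof (cases "y' \<le> t")
      case True
      then have "F y \<le> F y'" using y y' by auto
      with \<open>0 < e\<close> show ?thesis by simp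
    next
      case False
      then have "F t - e < F y'" using y' by (intro near) auto
      moreover have "F y \<le> F t" using y by auto
      ultimately show ?thesis by simp
    qed
    also have "F y' = measure excess (future_minima F s \<inter> {..x})"
      using measure_excess_future_minima[OF y'] by simp
    also have "\<dots> \<le> measure excess ?E"
    proof (rule excess.finite_measure_mono)
      have "ereal t < T u" if "u \<in> future_minima F s" for u
        using \<open>t < s\<close> le_exit_point_if_future_minima[OF that] by (metis less_ereal.simps(1) less_le_trans)
      then show "future_minima F s \<inter> {..x} \<subseteq> ?E" by auto
    qed auto
    finally show "F y \<le> measure excess ?E + e" by simp
  qed
qed

text \<open>
  The mass to the left of \<open>k\<close> that never exits is at most \<open>F t\<close> for every \<open>t \<ge> k\<close>, and \<open>F\<close>
  vanishes at infinity.
\<close>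
lemma AE_T_finite: "AE u in excess. \<bar>T u\<bar> \<noteq> \<infinity>"
proof -
  have null: "emeasure excess {u. u \<le> real k \<and> T u = \<infinity>} = 0" for k
  proof -
    have "measure excess {u. u \<le> real k \<and> T u = \<infinity>} \<le> 0"
    proof (rule tendsto_lowerbound[OF gap_at_top])
      show "\<forall>\<^sub>F t in at_top. measure excess {u. u \<le> real k \<and> T u = \<infinity>} \<le> F t"
        using eventually_ge_at_top[of "real k"]
      proof eventually_elim
        case (elim t)
        obtain y where y: "y \<in> {real k..t}" "\<forall>z\<in>{real k..t}. F y \<le> F z"
          using minimizer_on_interval[OF continuous_gap elim] by blast
        have "measure excess {u. u \<le> real k \<and> T u = \<infinity>}
            \<le> measure excess {u. u \<le> real k \<and> ereal t < T u}"
          by (intro excess.finite_measure_mono) auto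
        also have "\<dots> = F y" by (rule excess_crossing[OF y])
        also have "F y \<le> F t" using y elim by auto
        finally show ?case .
      qed
    qed simp
    then show ?thesis
      by (simp add: excess.emeasure_eq_measure measure_le_0_iff)
  qed
  have "AE u in excess. \<forall>k. \<not> (u \<le> real k \<and> T u = \<infinity>)"
    unfolding AE_all_countable
  proof
    fix k
    show "AE u in excess. \<not> (u \<le> real k \<and> T u = \<infinity>)"
      by (rule AE_I[OF _ null[of k]]) auto
  qed
  then show ?thesis
  proof eventually_elim
    case (elim u)
    moreover obtain k where "u \<le> real k" using real_arch_simple by blast
    moreover have "T u \<noteq> -\<infinity>" using le_exit_point[of u F] by auto
    ultimately show ?case by auto
  qed
qed

end

section \<open>A criterion for the optimal coupling\<close>

definition slice_above :: "(real \<times> real) measure \<Rightarrow> real \<Rightarrow> real measure" where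
  "slice_above P x = distr (density P (indicator ({x<..} \<times> UNIV))) borel snd"

lemma sets_slice_above [simp]: "sets (slice_above P x) = sets borel"
  by (simp add: slice_above_def)

lemma emeasure_slice_above:
  assumes P: "sets P = sets borel" and B: "B \<in> sets borel"
  shows "emeasure (slice_above P x) B = emeasure P ({x<..} \<times> B)"
proof -
  let ?D = "density P (indicator ({x<..} \<times> UNIV))"
  have H: "{x<..} \<times> (UNIV :: real set) \<in> sets P"
    unfolding P by (intro borel_open open_Times) auto
  have sp: "space P = UNIV" using sets_eq_imp_space_eq[OF P] by simp
  have snd: "snd \<in> measurable ?D borel"
    using P by (simp add: measurable_cong_sets[of ?D borel borel borel] borel_measurable_continuous_onI continuous_intros)
  have "emeasure (slice_above P x) B = emeasure ?D (snd -` B)"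
    unfolding slice_above_def using snd B by (simp add: emeasure_distr sp)
  also have "\<dots> = emeasure P (({x<..} \<times> UNIV) \<inter> snd -` B)"
    using measurable_sets[OF snd B] H by (intro emeasure_restricted) (auto simp: sp)
  also have "({x<..} \<times> UNIV) \<inter> snd -` B = {x<..} \<times> B" by auto
  finally show ?thesis .
qed

lemma Times_in_borel [simp]:
  "A \<in> sets borel \<Longrightarrow> B \<in> sets borel \<Longrightarrow> A \<times> B \<in> sets (borel :: (real \<times> real) measure)"
  unfolding borel_prod[symmetric] by (rule pair_measureI)

lemma halfplane_in_borel [simp]: "{(x, y). x \<le> y} \<in> sets (borel :: (real \<times> real) measure)"
proof -
  have "closed {p :: real \<times> real. fst p \<le> snd p}"
    by (intro closed_Collect_le continuous_intros)
  then show ?thesis by (simp add: case_prod_unfold)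
qed

text \<open>
  The sets \<open>(x, \<infinity>) \<times> B\<close> are closed under intersection and generate the Borel sets of the plane,
  since both projections are measurable with respect to the sets that they generate.
\<close>
lemma measure_eqI_upper_slices:
  fixes P Q :: "(real \<times> real) measure"
  assumes P: "finite_measure P" "sets P = sets borel" and Q: "sets Q = sets borel"
    and eq: "\<And>x B. B \<in> sets borel \<Longrightarrow> emeasure P ({x<..} \<times> B) = emeasure Q ({x<..} \<times> B)"
  shows "P = Q"
proof -
  interpret finite_measure P by fact
  define E :: "(real \<times> real) set set" where "E = {{x<..} \<times> B | x B. B \<in> sets borel}"
  have Times_E: "{x<..} \<times> B \<in> E" if "B \<in> sets borel" for x B
    using that by (auto simp: E_def)
  have UN_Times: "UNIV \<times> B = (\<Union>n::nat. {- real n<..} \<times> B)" for B :: "real set"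
    by (auto simp: minus_less_iff intro: reals_Archimedean2)
  let ?S = "sigma UNIV E"
  have sets_S: "sets ?S = sigma_sets UNIV E" by simp
  have fst: "fst \<in> measurable ?S borel"
  proof (rule borel_measurableI_greater)
    fix y :: real
    have "{p \<in> space ?S. y < fst p} = {y<..} \<times> UNIV" by auto
    then show "{p \<in> space ?S. y < fst p} \<in> sets ?S"
      using Times_E[of UNIV y] by (auto simp: sets_S)
  qed
  have snd: "snd \<in> measurable ?S borel"
  proof (rule measurableI)
    fix B :: "real set" assume B: "B \<in> sets borel"
    have "snd -` B \<inter> space ?S = (\<Union>n::nat. {- real n<..} \<times> B)"
      unfolding UN_Times[symmetric] by auto
    moreover have "(\<Union>n::nat. {- real n<..} \<times> B) \<in> sets ?S"
      using Times_E[OF B] by (intro sets.countable_UN) (auto simp: sets_S)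
    ultimately show "snd -` B \<inter> space ?S \<in> sets ?S" by simp
  qed simp
  have "(\<lambda>p. (fst p, snd p)) \<in> measurable ?S (borel \<Otimes>\<^sub>M borel)"
    by (rule measurable_Pair[OF fst snd])
  then have id: "(\<lambda>p. p) \<in> measurable ?S borel" by (simp add: borel_prod)
  have gen: "sets borel = sigma_sets UNIV E"
  proof
    show "sets borel \<subseteq> sigma_sets UNIV E"
      using measurable_sets[OF id] by (auto simp: sets_S)
    show "sigma_sets UNIV E \<subseteq> sets borel"
    proof -
      have "E \<subseteq> sets borel" by (auto simp: E_def)
      then show ?thesis using sets.sigma_sets_subset[of E borel] by simp
    qed
  qed
  show ?thesis
  proof (rule measure_eqI_generator_eq[where E = E and \<Omega> = UNIV and A = "\<lambda>n. {- real n<..} \<times> UNIV"])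
    show "Int_stable E"
    proof (rule Int_stableI)
      fix U V assume "U \<in> E" "V \<in> E"
      then obtain x B y C where *: "U = {x<..} \<times> B" "V = {y<..} \<times> C" "B \<in> sets borel" "C \<in> sets borel"
        by (auto simp: E_def)
      then have "U \<inter> V = {max x y<..} \<times> (B \<inter> C)" by auto
      with * show "U \<inter> V \<in> E" by (auto intro!: Times_E)
    qed
    show "(\<Union>n. {- real n<..} \<times> UNIV) = (UNIV :: (real \<times> real) set)"
      using UN_Times[of UNIV] by simp
    show "emeasure P ({- real n<..} \<times> UNIV) \<noteq> \<infinity>" for n
      by simp
    show "range (\<lambda>n. {- real n<..} \<times> UNIV) \<subseteq> E"
      using Times_E[of UNIV] by auto
  qed (use eq P(2) Q gen in \<open>auto simp: E_def\<close>)
qed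

text \<open>
  Mass that starts above \<open>x\<close> and ends below \<open>t\<close> has moved to the right, so it started in \<open>(x, t]\<close>.
\<close>
lemma slice_above_in_target_candidates:
  assumes dc: "directional_coupling \<mu> \<nu> P"
  shows "slice_above P x \<in> target_candidates \<mu> \<nu> x"
proof -
  from dc have P: "prob_space P" "sets P = sets borel"
    and \<mu>: "distr P borel fst = \<mu>" and \<nu>: "distr P borel snd = \<nu>"
    and H: "measure P {(x, y). x \<le> y} = 1"
    by (auto simp: directional_coupling_def)
  interpret prob_space P by fact
  have sp: "space P = UNIV" using sets_eq_imp_space_eq[OF P(2)] by simp
  have fst: "fst \<in> measurable P borel" and snd: "snd \<in> measurable P borel"
    using P(2) by (simp_all add: measurable_cong_sets[of P borel borel borel] borel_measurable_continuous_onI continuous_intros)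
  have em_\<mu>: "emeasure \<mu> B = emeasure P (B \<times> UNIV)" if "B \<in> sets borel" for B
    unfolding \<mu>[symmetric] using that fst
    by (simp add: emeasure_distr sp) (rule arg_cong[where f = "emeasure P"], auto)
  have em_\<nu>: "emeasure \<nu> B = emeasure P (UNIV \<times> B)" if "B \<in> sets borel" for B
    unfolding \<nu>[symmetric] using that snd
    by (simp add: emeasure_distr sp) (rule arg_cong[where f = "emeasure P"], auto)
  have sets_\<mu>: "sets \<mu> = sets borel" and sets_\<nu>: "sets \<nu> = sets borel"
    by (simp_all add: \<mu>[symmetric] \<nu>[symmetric])
  have above: "emeasure (restrict_above \<mu> x) B = emeasure P (({x<..} \<inter> B) \<times> UNIV)" if "B \<in> sets borel" for B
    unfolding restrict_above_def using that by (subst emeasure_restricted) (auto simp: sets_\<mu> em_\<mu>)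
  have AE_H: "AE p in P. p \<in> {(x, y). x \<le> y}"
    using H by (subst AE_in_set_eq_1) (auto simp: P)
  note slice = emeasure_slice_above[OF P(2)]
  have fin: "finite_borel_measure (slice_above P x)"
    by (rule finite_borel_measureI) (use sets_eq_imp_space_eq[OF sets_slice_above[of P x]] in \<open>auto simp: slice\<close>)
  have total: "measure (restrict_above \<mu> x) UNIV = measure (slice_above P x) UNIV"
    by (simp add: measure_def above slice)
  have "cdf (slice_above P x) t \<le> cdf (restrict_above \<mu> x) t" for t
  proof -
    have "measure P ({x<..} \<times> {..t}) \<le> measure P (({x<..} \<inter> {..t}) \<times> UNIV)"
    proof (rule finite_measure_mono_AE)
      show "AE p in P. p \<in> {x<..} \<times> {..t} \<longrightarrow> p \<in> ({x<..} \<inter> {..t}) \<times> UNIV"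
        using AE_H by eventually_elim auto
    qed (simp add: P)
    then show ?thesis by (simp add: cdf_def measure_def above slice)
  qed
  with total have "st_le (restrict_above \<mu> x) (slice_above P x)" by (simp add: st_le_def)
  moreover have "slice_above P x \<le> \<nu>"
    by (auto simp: le_measure sets_\<nu> slice em_\<nu> P intro!: emeasure_mono)
  ultimately show ?thesis using fin by (simp add: target_candidates_def)
qed

lemma st_le_antisym:
  assumes "finite_borel_measure \<theta>" "finite_borel_measure \<theta>'" "st_le \<theta> \<theta>'" "st_le \<theta>' \<theta>"
  shows "\<theta> = \<theta>'"
  using assms by (intro cdf_unique') (auto simp: st_le_def fun_eq_iff intro: antisym)

text \<open>A least candidate is the only minimal one, by antisymmetry of the stochastic order.\<close>
lemma minimal_target_eqI:
  assumes \<theta>: "\<theta> \<in> target_candidates \<mu> \<nu> x"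
    and least: "\<And>\<theta>'. \<theta>' \<in> target_candidates \<mu> \<nu> x \<Longrightarrow> st_le \<theta> \<theta>'"
  shows "minimal_target \<mu> \<nu> x = \<theta>"
  unfolding minimal_target_def
proof (rule the_equality)
  have fin: "finite_borel_measure \<theta>'" if "\<theta>' \<in> target_candidates \<mu> \<nu> x" for \<theta>'
    using that by (simp add: target_candidates_def)
  show "\<theta> \<in> target_candidates \<mu> \<nu> x \<and> (\<forall>\<theta>'\<in>target_candidates \<mu> \<nu> x. st_le \<theta>' \<theta> \<longrightarrow> \<theta>' = \<theta>)"
    using \<theta> least fin by (auto intro: st_le_antisym)
  show "\<theta>' = \<theta>" if "\<theta>' \<in> target_candidates \<mu> \<nu> x \<and> (\<forall>\<theta>''\<in>target_candidates \<mu> \<nu> x. st_le \<theta>'' \<theta>' \<longrightarrow> \<theta>'' = \<theta>')" for \<theta>'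
    using that \<theta> least by blast
qed

lemma optimal_coupling_eqI:
  assumes P: "directional_coupling \<mu> \<nu> P"
    and least: "\<And>x \<theta>. \<theta> \<in> target_candidates \<mu> \<nu> x \<Longrightarrow> st_le (slice_above P x) \<theta>"
  shows "optimal_coupling \<mu> \<nu> = P"
proof -
  have target: "minimal_target \<mu> \<nu> x = slice_above P x" for x
    by (intro minimal_target_eqI slice_above_in_target_candidates[OF P] least)
  have P': "prob_space P" "sets P = sets borel" using P by (auto simp: directional_coupling_def)
  show ?thesis
    unfolding optimal_coupling_def target
  proof (rule the_equality)
    show "directional_coupling \<mu> \<nu> P \<and>
        (\<forall>x. \<forall>B\<in>sets borel. emeasure P ({x<..} \<times> B) = emeasure (slice_above P x) B)"
      using P by (simp add: emeasure_slice_above P')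
    fix Q assume Q: "directional_coupling \<mu> \<nu> Q \<and>
        (\<forall>x. \<forall>B\<in>sets borel. emeasure Q ({x<..} \<times> B) = emeasure (slice_above P x) B)"
    then have "sets Q = sets borel" by (simp add: directional_coupling_def)
    then have "P = Q"
      using Q P' by (intro measure_eqI_upper_slices) (auto simp: emeasure_slice_above prob_space.finite_measure)
    then show "Q = P" by simp
  qed
qed

section \<open>The coupling along the exit point\<close>

lemma emeasure_graph_measure:
  assumes \<alpha>: "sets \<alpha> = sets borel" and S: "S \<in> borel_measurable borel" and C: "C \<in> sets borel"
  shows "emeasure (graph_measure \<alpha> S) C = emeasure \<alpha> {x. (x, real_of_ereal (S x)) \<in> C}"
proof -
  have "(\<lambda>x. (x, real_of_ereal (S x))) \<in> measurable borel (borel \<Otimes>\<^sub>M borel)"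
    using S by measurable
  then have "(\<lambda>x. (x, real_of_ereal (S x))) \<in> measurable \<alpha> borel"
    by (simp add: borel_prod measurable_cong_sets[OF \<alpha> refl])
  then show ?thesis
    unfolding graph_measure_def
    using C sets_eq_imp_space_eq[OF \<alpha>] by (simp add: emeasure_distr vimage_def)
qed

lemma sets_graph_measure [simp]: "sets (graph_measure \<alpha> S) = sets borel"
  by (simp add: graph_measure_def)

context ordered_atomless_pair
begin

definition coupling :: "(real \<times> real) measure" where
  "coupling = add_measure (graph_measure common (\<lambda>x. ereal x)) (graph_measure excess T)"

abbreviation g :: "real \<Rightarrow> real" where "g x \<equiv> real_of_ereal (T x)"

lemma sets_coupling: "sets coupling = sets borel"
  by (simp add: coupling_def)

lemma space_coupling: "space coupling = UNIV"
  using sets_eq_imp_space_eq[OF sets_coupling] by simp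

lemma emeasure_coupling:
  assumes "C \<in> sets borel"
  shows "emeasure coupling C = emeasure common {x. (x, x) \<in> C} + emeasure excess {x. (x, g x) \<in> C}"
  using assms by (simp add: coupling_def emeasure_add_measure emeasure_graph_measure sets_common sets_excess)

lemma emeasure_coupling_fst:
  assumes "B \<in> sets borel"
  shows "emeasure coupling (B \<times> UNIV) = emeasure \<mu> B"
  using assms by (simp add: emeasure_coupling emeasure_common_plus_excess)

sublocale coupling: prob_space coupling
  by (rule prob_spaceI)
     (use emeasure_coupling_fst[of UNIV] M.emeasure_space_1 in \<open>simp add: space_coupling\<close>)

lemma measure_coupling:
  assumes "C \<in> sets borel"
  shows "measure coupling C = measure common {x. (x, x) \<in> C} + measure excess {x. (x, g x) \<in> C}"
  using emeasure_coupling[OF assms]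
  by (simp add: coupling.emeasure_eq_measure common.emeasure_eq_measure excess.emeasure_eq_measure
      ennreal_plus[symmetric] del: ennreal_plus)

lemma measure_coupling_fst:
  assumes "B \<in> sets borel"
  shows "measure coupling (B \<times> UNIV) = measure \<mu> B"
  using emeasure_coupling_fst[OF assms] by (simp add: measure_def)

lemma AE_ereal_g: "AE u in excess. ereal (g u) = T u"
  using AE_T_finite by eventually_elim (simp add: ereal_real)

lemma excess_jump:
  assumes y: "y \<in> {x..t}" "\<forall>z\<in>{x..t}. F y \<le> F z"
  shows "measure excess {u. u \<le> x \<and> t < g u} = F y"
proof -
  have "measure excess {u. u \<le> x \<and> t < g u} = measure excess {u. u \<le> x \<and> ereal t < T u}"
  proof (rule excess.finite_measure_eq_AE)
    show "AE u in excess. u \<in> {u. u \<le> x \<and> t < g u} \<longleftrightarrow> u \<in> {u. u \<le> x \<and> ereal t < T u}"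
      using AE_ereal_g by eventually_elim (metis less_ereal.simps(1) mem_Collect_eq)
  qed measurable
  then show ?thesis using excess_crossing[OF y] by simp
qed

lemma AE_le_g: "AE u in excess. u \<le> g u"
  using AE_ereal_g
proof eventually_elim
  case (elim u)
  then show ?case using le_exit_point[of u F] by (metis ereal_less_eq(3))
qed

text \<open>
  Excess mass lands above \<open>t\<close> if it starts there or jumps over \<open>t\<close>; the jumping mass is \<open>F t\<close>, and
  this is exactly what \<open>\<nu>\<close> has above \<open>t\<close> in addition to \<open>\<mu>\<close>.
\<close>
lemma measure_coupling_snd_greater: "measure coupling (UNIV \<times> {t<..}) = 1 - cdf \<nu> t"
proof -
  have "measure excess {u. t < g u} = measure excess ({u. u \<le> t \<and> t < g u} \<union> {t<..})"
  proof (rule excess.finite_measure_eq_AE)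
    show "AE u in excess. u \<in> {u. t < g u} \<longleftrightarrow> u \<in> {u. u \<le> t \<and> t < g u} \<union> {t<..}"
      using AE_le_g by eventually_elim auto
  qed measurable
  also have "\<dots> = measure excess {u. u \<le> t \<and> t < g u} + measure excess {t<..}"
    by (rule excess.finite_measure_Union) auto
  also have "measure excess {u. u \<le> t \<and> t < g u} = F t"
    by (rule excess_jump) auto
  finally have "measure coupling (UNIV \<times> {t<..}) = F t + measure \<mu> {t<..}"
    using measure_common_plus_excess[of "{t<..}"]
    by (simp add: measure_coupling greaterThan_def)
  moreover have "measure \<mu> {t<..} = 1 - cdf \<mu> t"
    using M.prob_compl[of "{..t}"] by (simp add: cdf_def Compl_eq_Diff_UNIV[symmetric])
  ultimately show ?thesis by (simp add: cdf_gap_def)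
qed

lemma fst_snd_measurable_coupling:
  "fst \<in> measurable coupling borel" "snd \<in> measurable coupling borel"
  by (simp_all add: measurable_cong_sets[OF sets_coupling refl] borel_measurable_continuous_onI continuous_intros)

lemma distr_coupling_fst: "distr coupling borel fst = \<mu>"
proof (rule measure_eqI)
  fix B assume "B \<in> sets (distr coupling borel fst)"
  then have B: "B \<in> sets borel" by simp
  have "fst -` B = B \<times> (UNIV :: real set)" by auto
  then show "emeasure (distr coupling borel fst) B = emeasure \<mu> B"
    using B by (simp add: emeasure_distr fst_snd_measurable_coupling space_coupling emeasure_coupling_fst)
qed simp

lemma distr_coupling_snd: "distr coupling borel snd = \<nu>"
proof (rule cdf_unique)
  show "real_distribution (distr coupling borel snd)"
    by (intro coupling.real_distribution_distr fst_snd_measurable_coupling)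
  show "cdf (distr coupling borel snd) = cdf \<nu>"
  proof
    fix t
    have "measure (distr coupling borel snd) {..t} = measure coupling (snd -` {..t})"
      by (simp add: measure_distr fst_snd_measurable_coupling space_coupling)
    also have "snd -` {..t} = space coupling - UNIV \<times> {t<..}"
      by (auto simp: space_coupling)
    also have "measure coupling \<dots> = 1 - measure coupling (UNIV \<times> {t<..})"
      by (rule coupling.prob_compl) (simp add: sets_coupling)
    finally show "cdf (distr coupling borel snd) t = cdf \<nu> t"
      by (simp add: measure_coupling_snd_greater cdf_def)
  qed
qed (rule distr_\<nu>)

lemma directional_coupling_coupling: "directional_coupling \<mu> \<nu> coupling"
proof -
  have "measure excess {x. x \<le> g x} = measure excess UNIV"
    by (rule excess.finite_measure_eq_AE) (use AE_le_g in auto)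
  then have "measure coupling {(x, y). x \<le> y} = measure \<mu> UNIV"
    using measure_common_plus_excess[of UNIV] by (simp add: measure_coupling)
  then show ?thesis
    using M.prob_space coupling.prob_space_axioms
    by (simp add: directional_coupling_def sets_coupling distr_coupling_fst distr_coupling_snd)
qed

text \<open>Common mass does not move, so all mass that jumps over \<open>[x, t]\<close> is excess mass.\<close>
lemma measure_coupling_slice:
  assumes y: "y \<in> {x..t}" "\<forall>z\<in>{x..t}. F y \<le> F z"
  shows "measure coupling ({x<..} \<times> {..t}) = cdf \<nu> t - cdf \<mu> x + F y"
proof -
  have empty: "{u. u \<le> x \<and> t < u} = {}" using y by auto
  have "measure coupling ({..x} \<times> {t<..}) = F y"
    using excess_jump[OF y] by (simp add: measure_coupling empty)
  moreover have "measure coupling (UNIV \<times> {t<..})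
      = measure coupling ({..x} \<times> {t<..}) + measure coupling ({x<..} \<times> {t<..})"
    by (subst coupling.finite_measure_Union[symmetric])
       (auto simp: sets_coupling intro!: arg_cong[where f = "measure coupling"])
  moreover have "measure coupling ({x<..} \<times> UNIV)
      = measure coupling ({x<..} \<times> {..t}) + measure coupling ({x<..} \<times> {t<..})"
    by (subst coupling.finite_measure_Union[symmetric])
       (auto simp: sets_coupling intro!: arg_cong[where f = "measure coupling"])
  moreover have "measure coupling ({x<..} \<times> UNIV) = 1 - cdf \<mu> x"
    using M.prob_compl[of "{..x}"]
    by (simp add: measure_coupling_fst cdf_def Compl_eq_Diff_UNIV[symmetric])
  ultimately show ?thesis using measure_coupling_snd_greater[of t] by simp
qed

text \<open>
  The distribution function of a candidate is bounded by splitting its mass at a minimizer \<open>y\<close> of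
  \<open>F\<close> over \<open>[x, t]\<close>, and the slice of the coupling attains this bound.
\<close>
lemma slice_above_least:
  assumes \<theta>: "\<theta> \<in> target_candidates \<mu> \<nu> x"
  shows "st_le (slice_above coupling x) \<theta>"
proof -
  from \<theta> have "finite_borel_measure \<theta>" and st: "st_le (restrict_above \<mu> x) \<theta>" and "\<theta> \<le> \<nu>"
    by (auto simp: target_candidates_def)
  then interpret th: finite_borel_measure \<theta> by simp
  have le_\<nu>: "measure \<theta> B \<le> measure \<nu> B" for B
    using le_measureD3[OF \<open>\<theta> \<le> \<nu>\<close>, of B]
    by (simp add: th.M_is_borel th.emeasure_eq_measure N.emeasure_eq_measure)
  have restrict: "measure (restrict_above \<mu> x) B = measure \<mu> ({x<..} \<inter> B)" if "B \<in> sets borel" for B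
    using that by (simp add: restrict_above_def measure_def emeasure_restricted)
  have cdf_\<theta>: "cdf \<theta> s \<le> measure \<mu> {x<..s}" for s
  proof -
    have "{x<..} \<inter> {..s} = {x<..s}" by auto
    then have "cdf (restrict_above \<mu> x) s = measure \<mu> {x<..s}"
      using restrict[of "{..s}"] by (simp add: cdf_def)
    moreover have "cdf \<theta> s \<le> cdf (restrict_above \<mu> x) s"
      using st unfolding st_le_def by blast
    ultimately show ?thesis by simp
  qed
  have slice: "measure (slice_above coupling x) B = measure coupling ({x<..} \<times> B)" if "B \<in> sets borel" for B
    using that by (simp add: measure_def emeasure_slice_above sets_coupling)
  have "cdf \<theta> t \<le> cdf (slice_above coupling x) t" for t
  proof (cases "x \<le> t")
    case True
    obtain y where y: "y \<in> {x..t}" "\<forall>z\<in>{x..t}. F y \<le> F z"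
      using minimizer_on_interval[OF continuous_gap True] by blast
    have "cdf \<theta> t - cdf \<theta> y \<le> cdf \<nu> t - cdf \<nu> y"
    proof (cases "y = t")
      case False
      with y have "y < t" by simp
      then show ?thesis using le_\<nu>[of "{y<..t}"] by (simp add: th.cdf_diff_eq N.cdf_diff_eq)
    qed simp
    moreover have "cdf \<theta> y \<le> cdf \<mu> y - cdf \<mu> x"
      using cdf_\<theta>[of y] M.cdf_diff_eq[of x y] y by (cases "x = y") auto
    ultimately have "cdf \<theta> t \<le> cdf \<nu> t - cdf \<mu> x + F y" by (simp add: cdf_gap_def)
    also have "\<dots> = cdf (slice_above coupling x) t"
      by (simp add: measure_coupling_slice[OF y] cdf_def slice)
    finally show ?thesis .
  next
    case False
    then have "cdf \<theta> t \<le> 0" using cdf_\<theta>[of t] by simp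
    also have "0 \<le> cdf (slice_above coupling x) t" by (simp add: cdf_def)
    finally show ?thesis .
  qed
  moreover have "measure (slice_above coupling x) UNIV = measure \<theta> UNIV"
    using st by (simp add: st_le_def slice restrict measure_coupling_fst)
  ultimately show ?thesis by (simp add: st_le_def)
qed

lemma optimal_coupling_eq: "optimal_coupling \<mu> \<nu> = coupling"
  by (intro optimal_coupling_eqI directional_coupling_coupling slice_above_least)

section \<open>The Monge property\<close>

lemma diagonal_in_borel: "B \<in> sets borel \<Longrightarrow> {(x, y). x \<in> B \<and> x = y} \<in> sets (borel :: (real \<times> real) measure)"
proof -
  assume "B \<in> sets borel"
  then have "B \<times> UNIV \<in> sets (borel :: (real \<times> real) measure)" by simp
  moreover have "closed {p :: real \<times> real. fst p = snd p}"
    by (intro closed_Collect_eq continuous_intros)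
  ultimately have "(B \<times> UNIV) \<inter> {p :: real \<times> real. fst p = snd p} \<in> sets borel" by auto
  moreover have "(B \<times> UNIV) \<inter> {p :: real \<times> real. fst p = snd p} = {(x, y). x \<in> B \<and> x = y}" by auto
  ultimately show ?thesis by simp
qed

text \<open>
  The part \<open>\<theta>\<close> of the coupling on the diagonal lies below both marginals, hence below their infimum,
  while it contains the whole infimum and, in addition, the excess that stays in place.
\<close>
lemma excess_fixed_null: "emeasure excess {x. g x = x} = 0"
proof -
  define \<theta> where "\<theta> = distr (density coupling (indicator {(x, y). x \<in> UNIV \<and> x = y})) borel fst"
  have diag: "{(x, y). x \<in> B \<and> x = y} \<in> sets coupling" if "B \<in> sets borel" for B
    using diagonal_in_borel[OF that] by (simp add: sets_coupling)
  have \<theta>: "emeasure \<theta> B = emeasure coupling {(x, y). x \<in> B \<and> x = y}" if B: "B \<in> sets borel" for B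
  proof -
    have "emeasure \<theta> B = emeasure (density coupling (indicator {(x, y). x \<in> UNIV \<and> x = y})) (B \<times> UNIV)"
      unfolding \<theta>_def using B fst_snd_measurable_coupling(1)
      by (simp add: emeasure_distr space_coupling) (rule arg_cong2[where f = emeasure], auto)
    also have "\<dots> = emeasure coupling ({(x, y). x \<in> UNIV \<and> x = y} \<inter> B \<times> UNIV)"
      by (rule emeasure_restricted[OF diag]) (use B in \<open>simp_all add: sets_coupling\<close>)
    also have "{(x, y). x \<in> UNIV \<and> x = y} \<inter> B \<times> UNIV = {(x, y). x \<in> B \<and> x = y}" by auto
    finally show ?thesis .
  qed
  have "emeasure \<theta> UNIV \<le> emeasure common UNIV"
  proof (rule le_common)
    fix B :: "real set" assume B: "B \<in> sets borel"
    show "emeasure \<theta> B \<le> emeasure \<mu> B"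
      unfolding \<theta>[OF B] emeasure_coupling_fst[OF B, symmetric]
      by (rule emeasure_mono) (use B in \<open>auto simp: sets_coupling\<close>)
    have "emeasure \<nu> B = emeasure coupling (UNIV \<times> B)"
    proof -
      have "snd -` B = (UNIV :: real set) \<times> B" by auto
      then have "emeasure (distr coupling borel snd) B = emeasure coupling (UNIV \<times> B)"
        using B by (simp add: emeasure_distr fst_snd_measurable_coupling space_coupling)
      then show ?thesis by (simp add: distr_coupling_snd)
    qed
    then show "emeasure \<theta> B \<le> emeasure \<nu> B"
      unfolding \<theta>[OF B] by (auto intro!: emeasure_mono simp: sets_coupling B)
  qed (simp add: \<theta>_def)
  moreover have "emeasure \<theta> UNIV = emeasure common UNIV + emeasure excess {x. g x = x}"
    using diagonal_in_borel[of UNIV]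
    by (simp add: \<theta> emeasure_coupling) (rule arg_cong[where f = "emeasure excess"], auto)
  ultimately show ?thesis
    by (simp add: common.emeasure_eq_measure excess.emeasure_eq_measure
        ennreal_plus[symmetric] del: ennreal_plus) (simp add: measure_le_0_iff)
qed

text \<open>
  If the coupling is carried by the graph of \<open>S\<close>, comparing the mass of the diagonal over \<open>B\<close> in
  both descriptions shows that \<open>\<mu> \<and> \<nu>\<close> is \<open>\<mu>\<close> restricted to the fixed points of \<open>S\<close>.
  Conversely, a set that separates \<open>\<mu> \<and> \<nu>\<close> from the excess tells where to stay and where to follow
  \<open>T\<close>.
\<close>
lemma monge_type_coupling_iff: "monge_type \<mu> coupling \<longleftrightarrow> mutually_singular excess common"
proof
  assume "monge_type \<mu> coupling"
  then obtain S where S [measurable]: "S \<in> borel_measurable borel" and eq: "coupling = graph_measure \<mu> S"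
    by (auto simp: monge_type_def)
  define D where "D = {x. real_of_ereal (S x) = x}"
  have D [measurable]: "D \<in> sets borel" unfolding D_def by measurable
  have diag: "emeasure \<mu> (B \<inter> D) = emeasure common B" if B [measurable]: "B \<in> sets borel" for B
  proof -
    note Q = diagonal_in_borel[OF B]
    have "emeasure excess {x. x \<in> B \<and> x = g x} \<le> emeasure excess {x. g x = x}"
      by (rule emeasure_mono) auto
    then have "emeasure excess {x. x \<in> B \<and> x = g x} = 0" by (simp add: excess_fixed_null)
    then have "emeasure coupling {(x, y). x \<in> B \<and> x = y} = emeasure common B"
      by (simp add: emeasure_coupling[OF Q])
    moreover have "emeasure coupling {(x, y). x \<in> B \<and> x = y} = emeasure \<mu> (B \<inter> D)"
      unfolding eq by (subst emeasure_graph_measure[OF _ S Q]) (auto intro!: arg_cong[where f = "emeasure \<mu>"] simp: D_def)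
    ultimately show ?thesis by simp
  qed
  have "emeasure common (space common - D) = 0"
    using diag[of "-D"] by (simp add: common.borel_UNIV Compl_eq_Diff_UNIV[symmetric])
  moreover have "emeasure excess D = 0"
    using diag[of D] by (simp add: emeasure_excess M.emeasure_eq_measure)
  ultimately show "mutually_singular excess common"
    using D by (auto simp: mutually_singular_def sets_common sets_excess)
next
  assume "mutually_singular excess common"
  then obtain A where A [measurable]: "A \<in> sets borel" and null: "emeasure excess A = 0" "emeasure common (- A) = 0"
    by (auto simp: mutually_singular_def sets_common sets_excess common.borel_UNIV Compl_eq_Diff_UNIV)
  define S where "S x = (if x \<in> A then ereal x else T x)" for x
  have S [measurable]: "S \<in> borel_measurable borel" unfolding S_def by measurable
  have AE_common: "AE x in common. x \<in> A"
    by (rule AE_I[OF _ null(2)]) (auto simp: sets_common)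
  have AE_excess: "AE x in excess. x \<notin> A"
    by (rule AE_I[OF _ null(1)]) (auto simp: sets_excess)
  have \<mu>: "emeasure \<mu> B = emeasure common (B \<inter> A) + emeasure excess (B - A)" if [measurable]: "B \<in> sets borel" for B
  proof -
    have "emeasure common B = emeasure common (B \<inter> A)"
      by (rule emeasure_eq_AE) (use AE_common in auto)
    moreover have "emeasure excess B = emeasure excess (B - A)"
      by (rule emeasure_eq_AE) (use AE_excess in auto)
    ultimately show ?thesis using emeasure_common_plus_excess[OF that] by simp
  qed
  have "AE x in \<mu>. \<bar>S x\<bar> \<noteq> \<infinity>"
  proof -
    have "emeasure \<mu> {x. \<bar>S x\<bar> = \<infinity>} = 0"
    proof -
      have "{x. \<bar>S x\<bar> = \<infinity>} \<inter> A = {}" by (auto simp: S_def)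
      moreover have "emeasure excess ({x. \<bar>S x\<bar> = \<infinity>} - A) = emeasure excess {}"
        by (rule emeasure_eq_AE) (use AE_T_finite in \<open>auto simp: S_def\<close>)
      ultimately show ?thesis by (simp add: \<mu>)
    qed
    then show ?thesis by (intro AE_I[where N = "{x. \<bar>S x\<bar> = \<infinity>}"]) auto
  qed
  moreover have "coupling = graph_measure \<mu> S"
  proof (rule measure_eqI)
    fix C assume "C \<in> sets coupling"
    then have C: "C \<in> sets borel" by (simp add: sets_coupling)
    have pre: "{x. (x, f x) \<in> C} \<in> sets borel" if f [measurable]: "f \<in> borel_measurable borel" for f
    proof -
      have "(\<lambda>x. (x, f x)) \<in> measurable borel (borel \<Otimes>\<^sub>M borel)" by measurable
      from measurable_sets[OF this, of C] C show ?thesis by (simp add: borel_prod vimage_def)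
    qed
    have [measurable]: "{x. (x, x) \<in> C} \<in> sets borel" "{x. (x, g x) \<in> C} \<in> sets borel"
      "{x. (x, real_of_ereal (S x)) \<in> C} \<in> sets borel"
      by (intro pre; measurable)+
    have "emeasure common {x. (x, x) \<in> C} = emeasure common ({x. (x, real_of_ereal (S x)) \<in> C} \<inter> A)"
    proof (rule emeasure_eq_AE)
      show "AE x in common. x \<in> {x. (x, x) \<in> C} \<longleftrightarrow> x \<in> {x. (x, real_of_ereal (S x)) \<in> C} \<inter> A"
        using AE_common by eventually_elim (auto simp: S_def)
    qed measurable
    moreover have "emeasure excess {x. (x, g x) \<in> C} = emeasure excess ({x. (x, real_of_ereal (S x)) \<in> C} - A)"
    proof (rule emeasure_eq_AE)
      show "AE x in excess. x \<in> {x. (x, g x) \<in> C} \<longleftrightarrow> x \<in> {x. (x, real_of_ereal (S x)) \<in> C} - A"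
        using AE_excess by eventually_elim (auto simp: S_def)
    qed measurable
    ultimately show "emeasure coupling C = emeasure (graph_measure \<mu> S) C"
      by (simp add: emeasure_coupling C emeasure_graph_measure \<mu>)
  qed (simp add: sets_coupling)
  ultimately show "monge_type \<mu> coupling" unfolding monge_type_def using S by blast
qed

end

theorem corollary2p9:
  fixes \<mu> \<nu> \<mu>' :: "real measure" and T :: "real \<Rightarrow> ereal"
  assumes "real_distribution \<mu>" and "real_distribution \<nu>"
    and "atomless \<mu>" and "atomless \<nu>"
    and "st_le \<mu> \<nu>"
    and "\<mu>' = diff_measure \<mu> (inf \<mu> \<nu>)"
    and "T = exit_point (cdf_gap \<mu> \<nu>)"
  shows "T \<in> borel_measurable borel \<and> (AE x in \<mu>'. \<bar>T x\<bar> \<noteq> \<infinity>) \<and>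
    optimal_coupling \<mu> \<nu> =
      add_measure (graph_measure (inf \<mu> \<nu>) (\<lambda>x. ereal x)) (graph_measure \<mu>' T) \<and>
    (monge_type \<mu> (optimal_coupling \<mu> \<nu>) \<longleftrightarrow> mutually_singular \<mu>' (inf \<mu> \<nu>))"
proof -
  interpret ordered_atomless_pair \<mu> \<nu>
    using assms(1-5) by (rule ordered_atomless_pair.intro)
  show ?thesis
    unfolding assms(6,7)
    using measurable_T AE_T_finite optimal_coupling_eq monge_type_coupling_iff
    by (simp add: coupling_def)
qed

end
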